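(* A function $f:\mathbb{R}\to\mathbb{R}$ is continuous at a point $c\in\mathbb{R}$ if and only if its nonstandard extension ${}^\dagger f:\mathbb{R}^\omega\to\mathbb{R}^\omega$ is $F$-continuous at $c$ for every $F\in\mathfrak{F}$.
   Context: Background theory: ZF + Dependent Choices. $\mathfrak{F}$ is the set of all proper filters on $\omega$ that contain every cofinite subset of $\omega$. The $F$-hyperreal line ${}^\dagger\mathcal{R}$ is a possibility structure with set of viewpoints $\mathfrak{F}$ and domain $\mathbb{R}^\omega$, the set of functions $\omega\to\mathbb{R}$. Atomic formulas (in the language with a symbol for every finitary relation and function on $\mathbb{R}$) are forced at $F\in\mathfrak{F}$ according to: $F\Vdash R(\overline{a})$ iff $\{i\in\omega: R(\overline{a}(i))\text{ holds in }\mathbb{R}\}\in F$, operations being interpreted pointwise. In particular $F\Vdash|a-b|<\frac1n$ iff $\{i:|a(i)-b(i)|<\frac1n\}\in F$. The nonstandard extension ${}^\dagger f$ of $f:\mathbb{R}\to\mathbb{R}$ is the function $\mathbb{R}^\omega\to\mathbb{R}^\omega$ given by ${}^\dagger f(a)(i)=f(a(i))$; it is also denoted $f$. A real number $c$ is identified with the constant function $\delta(c)\in\mathbb{R}^\omega$ with value $c$. For $a\in\mathbb{R}^\omega$ and $F\in\mathfrak{F}$, the $F$-halo of $a$ is $(a)_F=\{b\in\mathbb{R}^\omega: F\Vdash|a-b|<\frac1n\text{ for all positive integers }n\}$. A function $g:\mathbb{R}^\omega\to\mathbb{R}^\omega$ is $F$-continuous at $c\in\mathbb{R}^\omega$ if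 for any $x\in(c)_F$, $g(x)\in(g(c))_F$. *)

theory Defs
  imports Complex_Main
begin

text \<open>
  A library filter \<open>F :: nat filter\<close> is given by its predicate \<open>\<lambda>P. eventually P F\<close>; a set \<open>X\<close> of
  indices belongs to it iff \<open>eventually (\<lambda>i. i \<in> X) F\<close>.  The improper filter is \<open>bot\<close>.  The library
  order is reverse inclusion, so \<open>F \<le> cofinite\<close> says that every cofinite set belongs to \<open>F\<close>.
\<close>

definition viewpoints :: "nat filter set" where
  "viewpoints = {F. F \<noteq> bot \<and> F \<le> cofinite}"

text \<open>
  Forcing of an atomic formula built from a binary relation \<open>R\<close> on the reals; \<open>F\<close> contains the set
  of indices at which \<open>R\<close> holds.  Only binary relations are needed below.
\<close>

definition forces :: "nat filter \<Rightarrow> (real \<Rightarrow> real \<Rightarrow> bool) \<Rightarrow> (nat \<Rightarrow> real) \<Rightarrow> (nat \<Rightarrow> real) \<Rightarrow> bool" where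
  "forces F R a b \<longleftrightarrow> eventually (\<lambda>i. i \<in> {i. R (a i) (b i)}) F"

definition delta :: "real \<Rightarrow> nat \<Rightarrow> real" where
  "delta c = (\<lambda>i. c)"

definition dagger :: "(real \<Rightarrow> real) \<Rightarrow> (nat \<Rightarrow> real) \<Rightarrow> (nat \<Rightarrow> real)" where
  "dagger f a = (\<lambda>i. f (a i))"

text \<open>
  The difference of two sequences is the pointwise one of the library, and \<open>dagger abs\<close> is the
  pointwise absolute value.
\<close>

definition halo :: "nat filter \<Rightarrow> (nat \<Rightarrow> real) \<Rightarrow> (nat \<Rightarrow> real) set" where
  "halo F a = {b. \<forall>n::nat. n > 0 \<longrightarrow> forces F (<) (dagger abs (a - b)) (delta (1 / real n))}"

lemma forces_abs_diff_less:
  "forces F (<) (dagger abs (a - b)) (delta e) \<longleftrightarrow> eventually (\<lambda>i. \<bar>a i - b i\<bar> < e) F"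
  by (simp add: forces_def dagger_def delta_def)

definition F_continuous_at :: "nat filter \<Rightarrow> ((nat \<Rightarrow> real) \<Rightarrow> (nat \<Rightarrow> real)) \<Rightarrow> (nat \<Rightarrow> real) \<Rightarrow> bool" where
  "F_continuous_at F g c \<longleftrightarrow> (\<forall>x \<in> halo F c. g x \<in> halo F (g c))"

end

theory Submission imports Defs begin

text \<open>
  Being in the \<open>F\<close>-halo of a real \<open>c\<close> is nothing but convergence to \<open>c\<close> along the filter \<open>F\<close>
  (\<open>halo_delta_iff_tendsto\<close>).  So \<open>F\<close>-continuity of the extension of \<open>f\<close> at \<open>c\<close> says that \<open>f\<close>
  preserves convergence to \<open>c\<close> along \<open>F\<close>, which follows from continuity because limits
  along a filter pass through continuous functions.

  Conversely, the cofinite filter is itself a viewpoint.  Convergence along it is the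
  usual convergence of sequences, so \<open>F\<close>-continuity at this single viewpoint is already sequential
  continuity, which for functions on the reals implies continuity.  This last step selects, if \<open>f\<close> is
  discontinuous at \<open>c\<close>, a sequence of witnesses \<open>x\<^sub>n\<close> within \<open>1 / n\<close> of \<open>c\<close> whose values under
  \<open>f\<close> stay away from \<open>f c\<close>.
\<close>

text \<open>
  The bounds \<open>1 / n\<close> come below every positive real by the Archimedean property, so the
  countably many conditions that define the halo give the \<open>\<epsilon>\<close>-condition of a limit.
\<close>

lemma halo_delta_iff_tendsto: "x \<in> halo F (delta c) \<longleftrightarrow> (x \<longlongrightarrow> c) F"
proof
  assume x: "x \<in> halo F (delta c)"
  show "(x \<longlongrightarrow> c) F"
  proof (rule tendstoI)
    fix e :: real
    assume "e > 0"
    then obtain m :: nat where m: "inverse (real (Suc m)) < e"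
      using reals_Archimedean by blast
    have "eventually (\<lambda>i. \<bar>c - x i\<bar> < 1 / real (Suc m)) F"
      using x by (auto simp: halo_def forces_abs_diff_less delta_def[of c] simp del: of_nat_Suc)
    then show "eventually (\<lambda>i. dist (x i) c < e) F"
      by eventually_elim (use m in \<open>simp add: dist_real_def abs_minus_commute inverse_eq_divide\<close>)
  qed
next
  assume x: "(x \<longlongrightarrow> c) F"
  have "eventually (\<lambda>i. \<bar>c - x i\<bar> < 1 / real n) F" if "n > 0" for n :: nat
    using tendstoD[OF x, of "1 / real n"] that by (simp add: dist_real_def abs_minus_commute)
  then show "x \<in> halo F (delta c)"
    by (simp add: halo_def forces_abs_diff_less delta_def[of c])
qed

lemma dagger_delta: "dagger f (delta c) = delta (f c)"
  by (simp add: dagger_def delta_def)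

lemma F_continuous_at_dagger_iff:
  "F_continuous_at F (dagger f) (delta c) \<longleftrightarrow>
    (\<forall>x. (x \<longlongrightarrow> c) F \<longrightarrow> ((\<lambda>i. f (x i)) \<longlongrightarrow> f c) F)"
  unfolding F_continuous_at_def Ball_def dagger_delta halo_delta_iff_tendsto
  by (simp add: dagger_def)

lemma sequentially_in_viewpoints: "sequentially \<in> viewpoints"
  by (simp add: viewpoints_def cofinite_eq_sequentially)

theorem theorem3p8:
  fixes f :: "real \<Rightarrow> real" and c :: real
  shows "isCont f c \<longleftrightarrow> (\<forall>F \<in> viewpoints. F_continuous_at F (dagger f) (delta c))"
proof
  assume "isCont f c"
  then show "\<forall>F \<in> viewpoints. F_continuous_at F (dagger f) (delta c)"
    by (auto simp: F_continuous_at_dagger_iff intro: isCont_tendsto_compose)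
next
  assume "\<forall>F \<in> viewpoints. F_continuous_at F (dagger f) (delta c)"
  then have "\<forall>x. x \<longlonglongrightarrow> c \<longrightarrow> (\<lambda>n. f (x n)) \<longlonglongrightarrow> f c"
    using sequentially_in_viewpoints by (simp add: F_continuous_at_dagger_iff)
  then show "isCont f c"
    by (simp add: isCont_def flip: LIMSEQ_SEQ_conv)
qed

end
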